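(* There is no SLOCAL algorithm that finds a proper $3$-coloring in $2$-dimensional grids with locality $o(n^{1/10})$, where $n$ is the number of nodes.
   Context: A $2$-dimensional grid with $n=a\times b$ nodes is the Cartesian product of a path with $a$ nodes and a path with $b$ nodes. $B(v,T)$ denotes the set of nodes within distance $T$ of $v$; $n$ is known to the algorithm. SLOCAL model with locality $T=T(n)$: the adversary assigns the nodes unique identifiers from $\{1,2,\dots,\mathrm{poly}(n)\}$ and chooses an ordering $v_1,\dots,v_n$ of the nodes. Each node has an unbounded local memory, initially empty. Nodes are processed one at a time in this order; when node $v$ is processed, it can read the graph structure, inputs, identifiers and local memories of all nodes in $B(v,T)$, and based on this it must choose its own final output and what to store in its own local memory. An algorithm solves the problem with locality $T$ if for every input graph and every adversarial choice (identifiers and order) the output is a proper $3$-coloring (adjacent nodes get different colors from a set of $3$ colors). *)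

theory Defs
  imports Complex_Main "HOL-Library.Landau_Symbols"
begin

text \<open>Undirected graphs are given by a vertex set and a symmetric set of ordered pairs.\<close>

type_synonym 'v graph = "'v set \<times> ('v \<times> 'v) set"

abbreviation verts :: "'v graph \<Rightarrow> 'v set" where "verts \<equiv> fst"
abbreviation edges :: "'v graph \<Rightarrow> ('v \<times> 'v) set" where "edges \<equiv> snd"

definition path_graph :: "nat \<Rightarrow> nat graph" where
  "path_graph a = ({0..<a}, {(i, j). i < a \<and> j < a \<and> (j = Suc i \<or> i = Suc j)})"

definition cartesian_product :: "'u graph \<Rightarrow> 'w graph \<Rightarrow> ('u \<times> 'w) graph" where
  "cartesian_product G H =
     (verts G \<times> verts H,
      {((u, w), (u', w')).
         (u = u' \<and> u \<in> verts G \<and> (w, w') \<in> edges H) \<or>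
         (w = w' \<and> w \<in> verts H \<and> (u, u') \<in> edges G)})"

definition grid :: "nat \<Rightarrow> nat \<Rightarrow> (nat \<times> nat) graph" where
  "grid a b = cartesian_product (path_graph a) (path_graph b)"

definition grids :: "(nat \<times> nat) graph set" where
  "grids = {grid a b | a b. a \<ge> 1 \<and> b \<ge> 1}"

definition gball :: "'v graph \<Rightarrow> 'v \<Rightarrow> nat \<Rightarrow> 'v set" where
  "gball G v T = {u \<in> verts G. \<exists>k\<le>T. (v, u) \<in> edges G ^^ k}"

definition proper_coloring :: "nat \<Rightarrow> 'v graph \<Rightarrow> ('v \<Rightarrow> nat) \<Rightarrow> bool" where
  "proper_coloring k G c \<longleftrightarrow>
     (\<forall>v\<in>verts G. c v < k) \<and> (\<forall>(u, v)\<in>edges G. c u \<noteq> c v)"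

text \<open>
  What a node sees when it is processed: the subgraph induced by its ball and the local
  memories there.  Nodes are named by their identifiers only, so that an algorithm has no
  access to the underlying vertices (here: grid coordinates).  The memory \<^term>\<open>None\<close> is the
  empty one; the content type \<open>'m\<close> is arbitrary.
\<close>

record 'm view =
  view_center :: nat
  view_nodes :: "nat set"
  view_edges :: "(nat \<times> nat) set"
  view_memory :: "(nat \<times> 'm option) set"

definition local_view ::
  "'v graph \<Rightarrow> ('v \<Rightarrow> nat) \<Rightarrow> nat \<Rightarrow> ('v \<Rightarrow> 'm option) \<Rightarrow> 'v \<Rightarrow> 'm view" where
  "local_view G ident T mem v =
     (let B = gball G v T in
      \<lparr> view_center = ident v,
        view_nodes = ident ` B,
        view_edges = {(ident u, ident w) | u w. u \<in> B \<and> w \<in> B \<and> (u, w) \<in> edges G},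
        view_memory = {(ident u, mem u) | u. u \<in> B} \<rparr>)"

text \<open>An algorithm maps the number of nodes and a view to an output and a new memory.\<close>

type_synonym ('m, 'o) slocal_alg = "nat \<Rightarrow> 'm view \<Rightarrow> 'o \<times> 'm option"

definition slocal_step ::
  "('m, 'o) slocal_alg \<Rightarrow> (nat \<Rightarrow> nat) \<Rightarrow> 'v graph \<Rightarrow> ('v \<Rightarrow> nat) \<Rightarrow> 'v \<Rightarrow>
   ('v \<Rightarrow> 'm option) \<times> ('v \<Rightarrow> 'o) \<Rightarrow> ('v \<Rightarrow> 'm option) \<times> ('v \<Rightarrow> 'o)" where
  "slocal_step A T G ident v =
     (\<lambda>(mem, out).
        let n = card (verts G); (c, m) = A n (local_view G ident (T n) mem v)
        in (mem(v := m), out(v := c)))"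

text \<open>The initial value of the output function is irrelevant: every node gets processed.\<close>

definition slocal_output ::
  "('m, 'o) slocal_alg \<Rightarrow> (nat \<Rightarrow> nat) \<Rightarrow> 'v graph \<Rightarrow> ('v \<Rightarrow> nat) \<Rightarrow> 'v list \<Rightarrow> 'v \<Rightarrow> 'o" where
  "slocal_output A T G ident vs =
     snd (fold (slocal_step A T G ident) vs (\<lambda>_. None, \<lambda>_. undefined))"

text \<open>Identifiers of an \<open>n\<close>-node graph are taken from \<open>{1..N n}\<close>.\<close>

definition slocal_solves ::
  "('m, 'o) slocal_alg \<Rightarrow> (nat \<Rightarrow> nat) \<Rightarrow> (nat \<Rightarrow> nat) \<Rightarrow> 'v graph set \<Rightarrow>
   ('v graph \<Rightarrow> ('v \<Rightarrow> 'o) \<Rightarrow> bool) \<Rightarrow> bool" where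
  "slocal_solves A T N \<G> P \<longleftrightarrow>
     (\<forall>G\<in>\<G>. \<forall>ident vs.
        inj_on ident (verts G) \<and> ident ` verts G \<subseteq> {1..N (card (verts G))} \<and>
        distinct vs \<and> set vs = verts G \<longrightarrow>
        P G (slocal_output A T G ident vs))"

end

theory Submission
  imports Defs
begin

text \<open>
  Summing the steps \<open>\<plusminus>1\<close> (mod 3) between consecutive colors along a path gives a height
  difference, which vanishes around every 4-cycle; hence the height differences along two
  parallel row segments at distance \<open>d\<close> differ by at most \<open>2 * d\<close>.  If the row segments
  are cut into tiles of odd width and processed in the right order, then the height difference
  between the centers of two consecutive tiles depends only on the identifiers in these two
  tiles, and being odd, it is not zero.  An Erdos-Szekeres argument on \<open>k\<^sup>2 + 1\<close> tiles
  yields \<open>k + 1\<close> tiles which, placed side by side, have height differences of the same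
  sign, so the total is at least \<open>k\<close> in absolute value.  Views carry no orientation, so
  mirroring a strip of tiles reverses the sign of its total.  Two strips with totals of opposite
  sign, one on top of the other, are contradictory as soon as \<open>k\<close> exceeds their distance.
\<close>

section \<open>Height steps of 3-colorings\<close>

text \<open>For distinct colors below 3 this is the representative of \<open>d - c\<close> modulo 3
  in \<open>{1, -1}\<close>. All other arguments also give \<open>1\<close> or \<open>-1\<close>, so
  parity and size are available for arbitrary color sequences.\<close>

definition color_step :: "nat \<Rightarrow> nat \<Rightarrow> int" where
  "color_step c d = (if d mod 3 = (c + 1) mod 3 then 1 else -1)"

lemma odd_color_step: "odd (color_step c d)"
  by (simp add: color_step_def)

lemma odd_sum_color_step: "odd (\<Sum>x<w. color_step (c x) (d x)) \<longleftrightarrow> odd (w :: nat)"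
  by (induction w) (simp_all add: odd_color_step)

lemma color_step_swap:
  assumes "c < 3" "d < 3" "c \<noteq> d"
  shows "color_step d c = - color_step c d"
proof -
  have "c = 0 \<or> c = 1 \<or> c = 2" "d = 0 \<or> d = 1 \<or> d = 2"
    using assms by auto
  then show ?thesis
    using assms(3) by (elim disjE) (simp_all add: color_step_def)
qed

text \<open>Both sides are congruent to \<open>d - a\<close> modulo 3 and lie in
  \<open>{-2, 0, 2}\<close>, whose elements are distinct modulo 3.\<close>

lemma color_step_square:
  assumes "a < 3" "b < 3" "c < 3" "d < 3" "a \<noteq> b" "b \<noteq> d" "a \<noteq> c" "c \<noteq> d"
  shows "color_step a b + color_step b d = color_step a c + color_step c d"
proof -
  have "a = 0 \<or> a = 1 \<or> a = 2" "b = 0 \<or> b = 1 \<or> b = 2"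
    "c = 0 \<or> c = 1 \<or> c = 2" "d = 0 \<or> d = 1 \<or> d = 2"
    using assms by auto
  then show ?thesis
    using assms(5-8) by (elim disjE) (simp_all add: color_step_def)
qed

lemma abs_color_step: "\<bar>color_step c d\<bar> = 1"
  by (simp add: color_step_def)

section \<open>Distances and balls in grids, heights along parallel rows\<close>

lemma verts_grid: "verts (grid a b) = {0..<a} \<times> {0..<b}"
  by (simp add: grid_def cartesian_product_def path_graph_def)

lemma edges_grid:
  "((x, y), (x', y')) \<in> edges (grid a b) \<longleftrightarrow>
     x < a \<and> x' < a \<and> y < b \<and> y' < b \<and> \<bar>int x - int x'\<bar> + \<bar>int y - int y'\<bar> = 1"
  by (auto simp: grid_def cartesian_product_def path_graph_def)

lemma relpow_grid_dist:
  assumes "((x, y), (x', y')) \<in> edges (grid a b) ^^ k"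
  shows "\<bar>int x - int x'\<bar> + \<bar>int y - int y'\<bar> \<le> int k"
  using assms
proof (induction k arbitrary: x' y')
  case 0
  then show ?case by simp
next
  case (Suc k)
  then obtain x1 y1 where "((x, y), (x1, y1)) \<in> edges (grid a b) ^^ k"
    and e: "((x1, y1), (x', y')) \<in> edges (grid a b)"
    by auto
  with Suc.IH have "\<bar>int x - int x1\<bar> + \<bar>int y - int y1\<bar> \<le> int k" by blast
  then show ?case using e by (auto simp: edges_grid)
qed

lemma grid_dist_relpow:
  assumes "x < a" "y < b" "x' < a" "y' < b" "\<bar>int x - int x'\<bar> + \<bar>int y - int y'\<bar> = int k"
  shows "((x, y), (x', y')) \<in> edges (grid a b) ^^ k"
  using assms
proof (induction k arbitrary: x' y')
  case 0
  then have "x = x'" "y = y'" by linarith+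
  then show ?case by simp
next
  case (Suc k)
  \<comment> \<open>The last node before \<open>(x', y')\<close> on a shortest walk from
    \<open>(x, y)\<close> that moves vertically first and horizontally afterwards.\<close>
  define x1 where "x1 = (if x' < x then x' + 1 else if x < x' then x' - 1 else x')"
  define y1 where "y1 = (if x' \<noteq> x then y' else if y' < y then y' + 1 else y' - 1)"
  have "((x, y), (x1, y1)) \<in> edges (grid a b) ^^ k"
    using Suc.prems by (intro Suc.IH) (auto simp: x1_def y1_def split: if_splits)
  moreover have "((x1, y1), (x', y')) \<in> edges (grid a b)"
    using Suc.prems unfolding edges_grid by (auto simp: x1_def y1_def split: if_splits)
  ultimately show ?case by (rule relpow_Suc_I)
qed

lemma gball_grid:
  assumes "x < a" "y < b"
  shows "(x', y') \<in> gball (grid a b) (x, y) t \<longleftrightarrow>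
    x' < a \<and> y' < b \<and> \<bar>int x - int x'\<bar> + \<bar>int y - int y'\<bar> \<le> int t"
    (is "?L \<longleftrightarrow> ?R")
proof
  assume ?L
  then show ?R using relpow_grid_dist by (fastforce simp: gball_def verts_grid)
next
  assume ?R
  then have "((x, y), (x', y')) \<in>
      edges (grid a b) ^^ nat (\<bar>int x - int x'\<bar> + \<bar>int y - int y'\<bar>)"
    using assms by (intro grid_dist_relpow) auto
  moreover have "nat (\<bar>int x - int x'\<bar> + \<bar>int y - int y'\<bar>) \<le> t"
    using \<open>?R\<close> by linarith
  ultimately show ?L using \<open>?R\<close> by (auto simp: gball_def verts_grid)
qed

text \<open>Two adjacent rows bound a ladder of 4-cycles. Telescoping
  \<open>color_step_square\<close> along it expresses the difference of the two row sums by the two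
  end rungs, each \<open>1\<close> or \<open>-1\<close>, so every further row adds at most
  2.\<close>

lemma row_sums_close:
  assumes "proper_coloring 3 (grid a b) c" "x0 + l < a" "y + d < b"
  shows "\<bar>(\<Sum>x<l. color_step (c (x0 + x, y)) (c (x0 + x + 1, y))) -
      (\<Sum>x<l. color_step (c (x0 + x, y + d)) (c (x0 + x + 1, y + d)))\<bar> \<le> 2 * int d"
  using assms(3)
proof (induction d)
  case 0
  then show ?case by simp
next
  case (Suc d)
  define row where "row l y = (\<Sum>x<l. color_step (c (x0 + x, y)) (c (x0 + x + 1, y)))" for l y
  define V where "V x = color_step (c (x, y + d)) (c (x, y + d + 1))" for x
  have lt: "c (x, y) < 3" if "x < a" "y < b" for x y
    using assms(1) that by (auto simp: proper_coloring_def verts_grid)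
  have ne: "c (x, y) \<noteq> c (x', y')" if "((x, y), (x', y')) \<in> edges (grid a b)" for x y x' y'
    using assms(1) that by (auto simp: proper_coloring_def)
  have "row j (y + d) + V (x0 + j) = V x0 + row j (y + d + 1)" if "j \<le> l" for j
    using that
  proof (induction j)
    case 0
    then show ?case by (simp add: row_def)
  next
    case (Suc j)
    have "color_step (c (x0 + j, y + d)) (c (x0 + j + 1, y + d)) + V (x0 + j + 1) =
        V (x0 + j) + color_step (c (x0 + j, y + d + 1)) (c (x0 + j + 1, y + d + 1))"
      unfolding V_def using Suc.prems \<open>y + Suc d < b\<close> assms(2)
      by (intro color_step_square lt ne) (auto simp: edges_grid)
    with Suc show ?case by (simp add: row_def)
  qed
  from this[of l] have "\<bar>row l (y + d) - row l (y + d + 1)\<bar> \<le> 2"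
    using abs_color_step[of "c (x0, y + d)" "c (x0, y + d + 1)"]
      abs_color_step[of "c (x0 + l, y + d)" "c (x0 + l, y + d + 1)"] unfolding V_def by linarith
  moreover have "\<bar>row l y - row l (y + d)\<bar> \<le> 2 * int d"
    using Suc by (simp add: row_def)
  ultimately have "\<bar>row l y - row l (y + Suc d)\<bar> \<le> 2 * int (Suc d)"
    by simp
  then show ?case by (simp add: row_def)
qed

section \<open>Runs in the order of ranks\<close>

text \<open>
  A run in which the nodes are processed by increasing rank, as a system of equations instead
  of a fold.  The rank of a node depends on its identifier only; nothing is said about nodes of
  equal rank except that they do not see each other's memory.
\<close>

definition is_run ::
  "('m, 'o) slocal_alg \<Rightarrow> nat \<Rightarrow> nat \<Rightarrow> (nat \<Rightarrow> nat) \<Rightarrow> 'v graph \<Rightarrow> ('v \<Rightarrow> nat) \<Rightarrow>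
   ('v \<Rightarrow> 'o \<times> 'm option) \<Rightarrow> bool" where
  "is_run A n t r G ident S \<longleftrightarrow>
     (\<forall>v\<in>verts G. S v = A n (local_view G ident t
        (\<lambda>u. if r (ident u) < r (ident v) then snd (S u) else None) v))"

text \<open>The equation at \<open>v\<close> reads memories of nodes of smaller rank only, so
  well-founded recursion along the rank yields a solution.\<close>

lemma run_exists:
  fixes A :: "('c, 'b) slocal_alg" and G :: "'a graph"
  shows "\<exists>S. is_run A n t r G ident S"
proof -
  define R where "R = measure (\<lambda>v. r (ident v))"
  define F :: "('a \<Rightarrow> 'b \<times> 'c option) \<Rightarrow> 'a \<Rightarrow> 'b \<times> 'c option" where
    "F S v = A n (local_view G ident t
      (\<lambda>u. if r (ident u) < r (ident v) then snd (S u) else None) v)" for S v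
  have "wfrec R F v = F (wfrec R F) v" for v
  proof -
    have "wfrec R F v = F (cut (wfrec R F) R v) v"
      by (rule wfrec) (simp add: R_def)
    also have "\<dots> = F (wfrec R F) v"
      unfolding F_def
      by (intro arg_cong[where f = "\<lambda>m. A n (local_view G ident t m v)"] ext)
        (simp add: cut_def R_def)
    finally show ?thesis .
  qed
  then have "is_run A n t r G ident (wfrec R F)"
    unfolding is_run_def by (simp add: F_def)
  then show ?thesis by blast
qed

text \<open>Each node writes its memory once, and all later nodes have larger rank. Hence the memory
  present when \<open>v\<close> is processed is the final memory with everything outside the smaller
  ranks erased; the conjunct on unprocessed nodes carries this through the induction.\<close>

lemma sorted_fold_slocal_step:
  fixes r :: "nat \<Rightarrow> nat"
  assumes "sorted_wrt (\<lambda>u v. r (ident u) < r (ident v)) vs"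
    and "fold (slocal_step A T G ident) vs (\<lambda>_. None, \<lambda>_. undefined) = (mem, out)"
  shows "(\<forall>u. u \<notin> set vs \<longrightarrow> mem u = None) \<and>
    (\<forall>v\<in>set vs. (out v, mem v) = A (card (verts G)) (local_view G ident (T (card (verts G)))
        (\<lambda>u. if r (ident u) < r (ident v) then mem u else None) v))"
  using assms
proof (induction vs arbitrary: mem out rule: rev_induct)
  case Nil
  then show ?case by auto
next
  case (snoc z vs)
  define n where "n = card (verts G)"
  obtain mem0 out0 where
    f: "fold (slocal_step A T G ident) vs (\<lambda>_. None, \<lambda>_. undefined) = (mem0, out0)"
    by fastforce
  obtain c m where cm: "A n (local_view G ident (T n) mem0 z) = (c, m)"
    by fastforce
  have mem: "mem = mem0(z := m)" and out: "out = out0(z := c)"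
    using snoc.prems(2) cm
    by (auto simp: f slocal_step_def[of A T G ident z] n_def[symmetric])
  have sorted: "sorted_wrt (\<lambda>u v. r (ident u) < r (ident v)) vs"
    and last: "\<And>u. u \<in> set vs \<Longrightarrow> r (ident u) < r (ident z)"
    using snoc.prems(1) by (auto simp: sorted_wrt_append)
  note IH = snoc.IH[OF sorted f, folded n_def, THEN conjunct1]
    snoc.IH[OF sorted f, folded n_def, THEN conjunct2]
  have "(\<lambda>u. if r (ident u) < r (ident z) then mem u else None) = mem0"
  proof
    fix u
    show "(if r (ident u) < r (ident z) then mem u else None) = mem0 u"
      using IH(1) last[of u] by (cases "u \<in> set vs") (auto simp: mem)
  qed
  then have z: "(out z, mem z) = A n (local_view G ident (T n)
      (\<lambda>u. if r (ident u) < r (ident z) then mem u else None) z)"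
    using cm by (simp add: mem out)
  have "(out v, mem v) = A n (local_view G ident (T n)
      (\<lambda>u. if r (ident u) < r (ident v) then mem u else None) v)" if "v \<in> set vs" for v
  proof -
    have "(\<lambda>u. if r (ident u) < r (ident v) then mem u else None) =
        (\<lambda>u. if r (ident u) < r (ident v) then mem0 u else None)"
      using last[OF that] by (auto simp: mem)
    moreover have "v \<noteq> z" using last[OF that] by auto
    then have "(out v, mem v) = (out0 v, mem0 v)"
      using \<open>v \<noteq> z\<close> by (simp add: mem out)
    ultimately show ?thesis using IH(2) that by simp
  qed
  moreover have "mem u = None" if "u \<notin> set (vs @ [z])" for u
    using IH(1) that by (simp add: mem)
  ultimately show ?case using z unfolding n_def by simp
qed

text \<open>The adversary presents the nodes by increasing rank. As ranks are injective on the
  identifiers, this is a legal order, and the fold along it solves the equations of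
  \<open>is_run\<close>.\<close>

lemma run_of_solves:
  assumes "slocal_solves A T N \<G> P" "G \<in> \<G>" "finite (verts G)"
    and ident: "inj_on ident (verts G)" "ident ` verts G \<subseteq> {1..N (card (verts G))}"
    and r: "inj_on r (ident ` verts G)"
  obtains S where "is_run A (card (verts G)) (T (card (verts G))) r G ident S"
    and "P G (\<lambda>v. fst (S v))"
proof -
  define q where "q = r \<circ> ident"
  have q: "inj_on q (verts G)"
    unfolding q_def using ident(1) r by (rule comp_inj_on)
  define vs where "vs = map (inv_into (verts G) q) (sorted_list_of_set (q ` verts G))"
  have mapq: "map q vs = sorted_list_of_set (q ` verts G)"
    unfolding vs_def map_map using assms(3)
    by (intro map_idI) (auto simp: f_inv_into_f)
  have "sorted_wrt (<) (map q vs)"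
    unfolding mapq by simp
  then have sorted: "sorted_wrt (\<lambda>u v. r (ident u) < r (ident v)) vs"
    by (simp add: sorted_wrt_map q_def)
  have set: "set vs = verts G"
    using assms(3) q by (simp add: vs_def)
  have dist: "distinct vs"
    using mapq by (metis distinct_map distinct_sorted_list_of_set)
  obtain mem out where
    f: "fold (slocal_step A T G ident) vs (\<lambda>_. None, \<lambda>_. undefined) = (mem, out)"
    by fastforce
  have "is_run A (card (verts G)) (T (card (verts G))) r G ident (\<lambda>v. (out v, mem v))"
    using sorted_fold_slocal_step[OF sorted f] set unfolding is_run_def snd_conv by blast
  moreover have "P G (slocal_output A T G ident vs)"
    using assms(1,2) ident set dist unfolding slocal_solves_def by blast
  ultimately show ?thesis
    using that f by (simp add: slocal_output_def)
qed

section \<open>Transfer of views and runs between graphs\<close>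

lemma local_view_transfer:
  assumes "gball H (f v) t = f ` gball G v t"
    and "\<And>u w. u \<in> gball G v t \<Longrightarrow> w \<in> gball G v t \<Longrightarrow>
           (f u, f w) \<in> edges H \<longleftrightarrow> (u, w) \<in> edges G"
    and "\<And>u. u \<in> gball G v t \<Longrightarrow> ident' (f u) = ident u"
    and "\<And>u. u \<in> gball G v t \<Longrightarrow> mem' (f u) = mem u"
    and "v \<in> gball G v t"
  shows "local_view H ident' t mem' (f v) = local_view G ident t mem v"
proof -
  define B where "B = gball G v t"
  have "ident' ` f ` B = ident ` B"
    using assms(3) by (force simp: B_def)
  moreover have "{(ident' u, ident' w) | u w. u \<in> f ` B \<and> w \<in> f ` B \<and> (u, w) \<in> edges H} =
      {(ident u, ident w) | u w. u \<in> B \<and> w \<in> B \<and> (u, w) \<in> edges G}" (is "?L = ?R")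
  proof (intro equalityI subsetI)
    fix p assume "p \<in> ?L"
    then show "p \<in> ?R" using assms(2,3) by (fastforce simp: B_def)
  next
    fix p assume "p \<in> ?R"
    then obtain u w where "p = (ident u, ident w)" "u \<in> B" "w \<in> B" "(u, w) \<in> edges G"
      by blast
    then have "p = (ident' (f u), ident' (f w)) \<and> f u \<in> f ` B \<and> f w \<in> f ` B \<and>
        (f u, f w) \<in> edges H"
      using assms(2,3) by (simp add: B_def)
    then show "p \<in> ?L" by blast
  qed
  moreover have "{(ident' u, mem' u) | u. u \<in> f ` B} = {(ident u, mem u) | u. u \<in> B}"
  proof -
    have "{(ident' u, mem' u) | u. u \<in> f ` B} = (\<lambda>u. (ident' (f u), mem' (f u))) ` B"
      by blast
    also have "\<dots> = (\<lambda>u. (ident u, mem u)) ` B"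
      using assms(3,4) by (intro image_cong) (auto simp: B_def)
    finally show ?thesis by blast
  qed
  moreover have "ident' (f v) = ident v"
    using assms(3,5) by blast
  ultimately show ?thesis
    using assms(1) by (simp add: local_view_def B_def Let_def)
qed

text \<open>Induction on the rank. A node in the ball of smaller rank than \<open>v\<close> is in
  \<open>C\<close> by \<open>closed\<close>, so the induction hypothesis gives its memory; every
  other node there counts as empty in both runs. Thus the two graphs have to agree only around
  \<open>C\<close>.\<close>

lemma run_transfer:
  assumes G: "is_run A n t r G ident S" and H: "is_run A n t r H ident' S'"
    and C: "C \<subseteq> verts G" "f ` C \<subseteq> verts H"
    and ball: "\<And>v. v \<in> C \<Longrightarrow> gball H (f v) t = f ` gball G v t"
    and edges: "\<And>v u w. v \<in> C \<Longrightarrow> u \<in> gball G v t \<Longrightarrow> w \<in> gball G v t \<Longrightarrow>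
           (f u, f w) \<in> edges H \<longleftrightarrow> (u, w) \<in> edges G"
    and ident: "\<And>v u. v \<in> C \<Longrightarrow> u \<in> gball G v t \<Longrightarrow> ident' (f u) = ident u"
    and closed: "\<And>v u. v \<in> C \<Longrightarrow> u \<in> gball G v t \<Longrightarrow> r (ident u) < r (ident v) \<Longrightarrow> u \<in> C"
    and v: "v \<in> C"
  shows "S' (f v) = S v"
  using v
proof (induction "r (ident v)" arbitrary: v rule: less_induct)
  case less
  have "v \<in> verts G" using less.prems C by blast
  then have v: "v \<in> gball G v t"
    by (auto simp: gball_def intro: exI[of _ 0])
  then have iv: "ident' (f v) = ident v"
    using ident less.prems by blast
  have "local_view H ident' t
        (\<lambda>u. if r (ident' u) < r (ident' (f v)) then snd (S' u) else None) (f v) =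
      local_view G ident t (\<lambda>u. if r (ident u) < r (ident v) then snd (S u) else None) v"
    using less.prems v iv less.hyps closed
    by (intro local_view_transfer ball edges) (auto simp: ident)
  moreover have "f v \<in> verts H" using less.prems C by blast
  ultimately show ?case
    using G H \<open>v \<in> verts G\<close> by (simp add: is_run_def)
qed

text \<open>\<open>f\<close> shifts the rows and shifts or mirrors the columns, hence preserves the
  grid distance; \<open>a - 1 \<le> X\<close> keeps the truncated subtraction exact. The margins
  \<open>v\<close> ensure that the target grid has no further node within distance \<open>t\<close>
  of the image of \<open>(x, y)\<close>.\<close>

lemma gball_grid_transfer:
  fixes X Y t :: nat and g :: "nat \<Rightarrow> nat"
  assumes g: "g = (\<lambda>x. X + x) \<or> g = (\<lambda>x. X - x) \<and> a - 1 \<le> X"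
    and sub: "\<And>x y. x < a \<Longrightarrow> y < b \<Longrightarrow> g x < a' \<and> Y + y < b'"
    and v: "t \<le> x" "x + t < a" "t \<le> y" "y + t < b"
  defines "f \<equiv> \<lambda>(x, y). (g x, Y + y)"
  shows "gball (grid a' b') (f (x, y)) t = f ` gball (grid a b) (x, y) t"
    and "\<And>u w. u \<in> verts (grid a b) \<Longrightarrow> w \<in> verts (grid a b) \<Longrightarrow>
      (f u, f w) \<in> edges (grid a' b') \<longleftrightarrow> (u, w) \<in> edges (grid a b)"
proof -
  have dist: "\<bar>int (g x) - int (g x')\<bar> = \<bar>int x - int x'\<bar>" if "x < a" "x' < a" for x x'
    using g that by auto
  have in': "g x < a'" "Y + y < b'" using sub[of x y] v by auto
  show "(f u, f w) \<in> edges (grid a' b') \<longleftrightarrow> (u, w) \<in> edges (grid a b)"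
    if "u \<in> verts (grid a b)" "w \<in> verts (grid a b)" for u w
    using that sub dist by (cases u; cases w) (auto simp: f_def edges_grid verts_grid)
  show "gball (grid a' b') (f (x, y)) t = f ` gball (grid a b) (x, y) t"
  proof (intro equalityI subsetI)
    fix p assume p: "p \<in> gball (grid a' b') (f (x, y)) t"
    obtain x' y' where p': "p = (x', y')" by fastforce
    have d: "\<bar>int (g x) - int x'\<bar> + \<bar>int (Y + y) - int y'\<bar> \<le> int t"
      using p in' by (simp add: p' f_def gball_grid)
    obtain x1 where x1: "g x1 = x'" "x1 < a"
      using g
    proof
      assume "g = (\<lambda>x. X + x)"
      then show thesis using d v by (intro that[of "x' - X"]) auto
    next
      assume "g = (\<lambda>x. X - x) \<and> a - 1 \<le> X"
      then show thesis using d v by (intro that[of "X - x'"]) auto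
    qed
    have y1: "Y + (y' - Y) = y'" "y' - Y < b"
      using d v by auto
    have "\<bar>int x - int x1\<bar> + \<bar>int y - int (y' - Y)\<bar> \<le> int t"
      using d dist[of x x1] x1 y1 v by auto
    then have "(x1, y' - Y) \<in> gball (grid a b) (x, y) t"
      using x1 y1 v by (simp add: gball_grid)
    moreover have "p = f (x1, y' - Y)"
      using x1 y1 by (simp add: f_def p')
    ultimately show "p \<in> f ` gball (grid a b) (x, y) t" by blast
  next
    fix p assume "p \<in> f ` gball (grid a b) (x, y) t"
    then obtain x' y' where "p = (g x', Y + y')" "(x', y') \<in> gball (grid a b) (x, y) t"
      by (auto simp: f_def)
    then show "p \<in> gball (grid a' b') (f (x, y)) t"
      using in' v sub[of x' y'] dist[of x x'] by (auto simp: f_def gball_grid)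
  qed
qed

section \<open>Chains of constant sign and extension of identifiers\<close>

text \<open>\<open>L\<close> may fail to be transitive, which is why only consecutive entries are
  compared. Let \<open>B\<close> be the elements with a smaller \<open>L\<close>-predecessor. If
  more than \<open>q\<close> elements lie outside \<open>B\<close>, they form a negative chain,
  since no two of them are related upwards. Otherwise \<open>B\<close> has more than
  \<open>k * q\<close> elements, and a positive chain in \<open>B\<close> is extended at the front
  by a predecessor of its head.\<close>

lemma monochromatic_chain:
  fixes A :: "nat set"
  assumes "finite A" "k * q < card A"
  shows "(\<exists>xs. length xs = Suc k \<and> set xs \<subseteq> A \<and> sorted_wrt (<) xs \<and> successively L xs) \<or>
    (\<exists>xs. length xs = Suc q \<and> set xs \<subseteq> A \<and> sorted_wrt (<) xs \<and>
       successively (\<lambda>i j. \<not> L i j) xs)"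
    (is "?pos k A \<or> ?neg A")
  using assms
proof (induction k arbitrary: A)
  case 0
  then obtain a where "a \<in> A" by (metis all_not_in_conv card.empty less_irrefl mult_0)
  then show ?case by (intro disjI1 exI[of _ "[a]"]) simp
next
  case (Suc k)
  define B where "B = {j \<in> A. \<exists>i\<in>A. i < j \<and> L i j}"
  have "B \<subseteq> A" by (auto simp: B_def)
  show ?case
  proof (cases "q < card (A - B)")
    case True
    define ys where "ys = sorted_list_of_set (A - B)"
    define xs where "xs = take (Suc q) ys"
    have "length xs = Suc q" using True by (simp add: xs_def ys_def)
    moreover have sub: "set xs \<subseteq> A - B"
      using set_take_subset[of "Suc q" ys] Suc.prems(1) by (simp add: xs_def ys_def)
    moreover have sorted: "sorted_wrt (<) xs"
      unfolding xs_def ys_def by (intro sorted_wrt_take) simp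
    moreover have "sorted_wrt (\<lambda>i j. \<not> L i j) xs"
      using sub by (intro sorted_wrt_mono_rel[OF _ sorted]) (auto simp: B_def)
    ultimately show ?thesis
      by (intro disjI2 exI[of _ xs]) (auto intro: successively_if_sorted_wrt)
  next
    case False
    have "card A = card B + card (A - B)"
      using \<open>B \<subseteq> A\<close> Suc.prems(1) by (metis add.commute card_Diff_subset card_mono
          finite_subset le_add_diff_inverse2)
    then have "k * q < card B" using False Suc.prems(2) by simp
    moreover have "finite B" using \<open>B \<subseteq> A\<close> Suc.prems(1) finite_subset by blast
    ultimately consider "?pos k B" | "?neg B" using Suc.IH by blast
    then show ?thesis
    proof cases
      case 1
      then obtain xs where xs: "length xs = Suc k" "set xs \<subseteq> B" "sorted_wrt (<) xs"
        "successively L xs" by blast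
      then obtain z zs where z: "xs = z # zs" by (cases xs) auto
      then obtain i where "i \<in> A" "i < z" "L i z" using xs(2) by (auto simp: B_def)
      then have "length (i # xs) = Suc (Suc k) \<and> set (i # xs) \<subseteq> A \<and> sorted_wrt (<) (i # xs) \<and>
          successively L (i # xs)"
        using xs \<open>B \<subseteq> A\<close> by (auto simp: z)
      then show ?thesis by blast
    next
      case 2
      then show ?thesis using \<open>B \<subseteq> A\<close> by blast
    qed
  qed
qed

lemma inj_on_extend:
  assumes "finite V" "finite B" "card V \<le> card B" "S \<subseteq> V" "inj_on f S" "f ` S \<subseteq> B"
  obtains g where "inj_on g V" "g ` V \<subseteq> B" "\<forall>v\<in>S. g v = f v"
proof -
  have fin: "finite S" using assms finite_subset by blast
  have "card (V - S) \<le> card (B - f ` S)"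
    using assms fin by (simp add: card_Diff_subset card_image diff_le_mono)
  then obtain h where h: "inj_on h (V - S)" "h ` (V - S) \<subseteq> B - f ` S"
    using assms by (metis finite_Diff inj_on_iff_card_le)
  define g where "g v = (if v \<in> S then f v else h v)" for v
  have "inj_on g V"
  proof (rule inj_onI)
    fix u v assume uv: "u \<in> V" "v \<in> V" "g u = g v"
    show "u = v"
    proof (cases "u \<in> S"; cases "v \<in> S")
      assume "u \<in> S" "v \<in> S"
      then show ?thesis using uv assms(5) by (simp add: g_def inj_onD)
    next
      assume "u \<notin> S" "v \<notin> S"
      then show ?thesis using uv h(1) by (simp add: g_def inj_onD)
    next
      assume "u \<in> S" "v \<notin> S"
      then have "h v \<in> f ` S" using uv by (metis g_def imageI)
      then show ?thesis using h(2) uv \<open>v \<notin> S\<close> by blast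
    next
      assume "u \<notin> S" "v \<in> S"
      then have "h u \<in> f ` S" using uv by (metis g_def imageI)
      then show ?thesis using h(2) uv \<open>u \<notin> S\<close> by blast
    qed
  qed
  moreover have "g ` V \<subseteq> B" using assms(6) h(2) by (auto simp: g_def)
  ultimately show ?thesis using that by (simp add: g_def)
qed

section \<open>Tiles and the height differences of pairs of tiles\<close>

text \<open>
  Tiles have \<open>4 * t + 1\<close> columns and \<open>2 * t + 1\<close> rows; \<open>e i x y\<close> is the identifier of the
  node \<open>(x, y)\<close> of tile \<open>i\<close>.  In the middle row, the block of columns \<open>t..3 * t\<close> is processed
  first, everything else in the middle row second.  A block sees its own tile only, and it
  separates the gaps on its two sides: no node in one gap sees a node in the other.
\<close>

locale tiling =
  fixes A :: "('m, nat) slocal_alg" and n t :: nat and r :: "nat \<Rightarrow> nat"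
    and e :: "nat \<Rightarrow> nat \<Rightarrow> nat \<Rightarrow> nat" and I :: "nat set"
  assumes middle_row_first:
      "\<lbrakk>i \<in> I; j \<in> I; x < 4 * t + 1; y < 2 * t + 1; x' < 4 * t + 1;
        r (e i x y) < r (e j x' t)\<rbrakk> \<Longrightarrow> y = t"
    and block_first:
      "\<lbrakk>i \<in> I; j \<in> I; x < 4 * t + 1; y < 2 * t + 1; t \<le> x'; x' \<le> 3 * t;
        r (e i x y) < r (e j x' t)\<rbrakk> \<Longrightarrow> t \<le> x \<and> x \<le> 3 * t"
begin

definition pair_ident :: "nat \<Rightarrow> nat \<Rightarrow> nat \<times> nat \<Rightarrow> nat" where
  "pair_ident i j = (\<lambda>(x, y). if x < 4 * t + 1 then e i x y else e j (x - (4 * t + 1)) y)"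

text \<open>The two tiles are run as a grid of their own, but the algorithm is told \<open>n\<close>
  instead of the size of this grid, so nothing forces the resulting colors to be proper.\<close>

definition pair_run :: "nat \<Rightarrow> nat \<Rightarrow> nat \<times> nat \<Rightarrow> nat \<times> 'm option" where
  "pair_run i j = (SOME S. is_run A n t r (grid (8 * t + 2) (2 * t + 1)) (pair_ident i j) S)"

definition pair_color :: "nat \<Rightarrow> nat \<Rightarrow> nat \<Rightarrow> nat" where
  "pair_color i j x = fst (pair_run i j (x, t))"

text \<open>The height difference in the middle row from the center \<open>2 * t\<close> of the
  first tile to the center \<open>6 * t + 1\<close> of the second.\<close>

definition pair_sum :: "nat \<Rightarrow> nat \<Rightarrow> int" where
  "pair_sum i j =
     (\<Sum>x<4 * t + 1. color_step (pair_color i j (2 * t + x)) (pair_color i j (2 * t + x + 1)))"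

lemma is_run_pair_run:
  "is_run A n t r (grid (8 * t + 2) (2 * t + 1)) (pair_ident i j) (pair_run i j)"
  unfolding pair_run_def using run_exists by (rule someI_ex)

text \<open>The number of steps, \<open>4 * t + 1\<close>, is odd, and the parity argument holds for
  improper colors as well.\<close>

lemma pair_sum_nonzero: "pair_sum i j \<noteq> 0"
proof -
  have "odd (pair_sum i j)" unfolding pair_sum_def odd_sum_color_step by simp
  then show ?thesis by auto
qed

text \<open>This is the condition \<open>closed\<close> of \<open>run_transfer\<close> for the
  middle row without its \<open>t\<close> outermost columns on either side. For \<open>x\<close> in
  a block, all nodes of smaller rank lie in blocks, that is in the columns \<open>t\<close> to
  \<open>3 * t\<close> and \<open>5 * t + 1\<close> to \<open>7 * t + 1\<close>.\<close>

lemma pair_closed: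
  assumes ij: "i \<in> I" "j \<in> I" and x: "t \<le> x" "x \<le> 7 * t + 1"
    and u: "x' < 8 * t + 2" "y' < 2 * t + 1" "\<bar>int x - int x'\<bar> \<le> int t"
    and less: "r (pair_ident i j (x', y')) < r (pair_ident i j (x, t))"
  shows "y' = t \<and> t \<le> x' \<and> x' \<le> 7 * t + 1"
proof -
  define w where "w = 4 * t + 1"
  obtain i1 z1 where 1: "i1 \<in> I" "z1 < w" "pair_ident i j (x', y') = e i1 z1 y'"
    and z1: "z1 = x' \<or> x' = z1 + w"
  proof (cases "x' < w")
    case True
    then show thesis using ij by (intro that[of i x']) (auto simp: pair_ident_def w_def)
  next
    case False
    then show thesis
      using ij u(1) by (intro that[of j "x' - w"]) (auto simp: pair_ident_def w_def)
  qed
  obtain i2 z2 where 2: "i2 \<in> I" "z2 < w" "pair_ident i j (x, t) = e i2 z2 t"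
    and z2: "z2 = x \<or> x = z2 + w"
  proof (cases "x < w")
    case True
    then show thesis using ij by (intro that[of i x]) (auto simp: pair_ident_def w_def)
  next
    case False
    then show thesis
      using ij x by (intro that[of j "x - w"]) (auto simp: pair_ident_def w_def)
  qed
  have y': "y' = t"
    using middle_row_first[of i1 i2 z1 y' z2] 1 2 u(2) less by (simp add: w_def)
  show ?thesis
  proof (cases "t \<le> z2 \<and> z2 \<le> 3 * t")
    case True
    then have "t \<le> z1 \<and> z1 \<le> 3 * t"
      using block_first[of i1 i2 z1 y' z2] 1 2 u(2) less by (simp add: w_def)
    then show ?thesis using y' z1 by (auto simp: w_def)
  next
    case False
    \<comment> \<open>Here \<open>x\<close> lies in the gap between the two blocks, and a ball of
      radius \<open>t\<close> around it stays strictly between the columns \<open>2 * t\<close> and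
      \<open>6 * t + 1\<close>.\<close>
    then have "3 * t < x" "x < 5 * t + 1" using z2 2(2) x by (auto simp: w_def)
    then show ?thesis using y' u(3) by auto
  qed
qed

text \<open>The balls around the columns \<open>t\<close> to \<open>7 * t + 1\<close> of the middle
  row stay inside the pair, so with \<open>pair_closed\<close> the run on them is the same wherever
  a shifted or mirrored copy of the pair occurs.\<close>

lemma pair_color_transfer:
  assumes run: "is_run A n t r (grid a b) ident S" and ij: "i \<in> I" "j \<in> I"
    and g: "g = (\<lambda>x. X + x) \<or> g = (\<lambda>x. X - x) \<and> 8 * t + 1 \<le> X"
    and sub: "\<And>x y. x < 8 * t + 2 \<Longrightarrow> y < 2 * t + 1 \<Longrightarrow>
       g x < a \<and> Y + y < b \<and> ident (g x, Y + y) = pair_ident i j (x, y)"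
    and x: "t \<le> x" "x \<le> 7 * t + 1"
  shows "fst (S (g x, Y + t)) = pair_color i j x"
proof -
  define f where "f = (\<lambda>(x, y). (g x, Y + y))"
  define C where "C = {t..7 * t + 1} \<times> {t}"
  define G where "G = grid (8 * t + 2) (2 * t + 1)"
  have verts: "gball G v t \<subseteq> verts G" for v by (auto simp: gball_def)
  note tr = gball_grid_transfer[of g X "8 * t + 2" "2 * t + 1" a Y b t, folded f_def G_def]
  have "S (f (x, t)) = pair_run i j (x, t)"
  proof (rule run_transfer[where C = C and f = f and S' = S and S = "pair_run i j"])
    show "is_run A n t r G (pair_ident i j) (pair_run i j)"
      unfolding G_def by (rule is_run_pair_run)
    show "is_run A n t r (grid a b) ident S" by (rule run)
    show "C \<subseteq> verts G" "f ` C \<subseteq> verts (grid a b)" "(x, t) \<in> C"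
      using x sub[of 0 t] sub[of _ t] by (auto simp: C_def G_def verts_grid f_def)
    fix v assume v: "v \<in> C"
    then obtain z where z: "v = (z, t)" "t \<le> z" "z \<le> 7 * t + 1" by (auto simp: C_def)
    show "gball (grid a b) (f v) t = f ` gball G v t"
      unfolding z(1) using z g sub by (intro tr(1)) auto
    fix u assume u: "u \<in> gball G v t"
    obtain x' y' where u': "u = (x', y')" by fastforce
    have u_in: "x' < 8 * t + 2" "y' < 2 * t + 1" using subsetD[OF verts u] by (auto simp: u' G_def verts_grid)
    show "ident (f u) = pair_ident i j u"
      using sub[OF u_in] by (simp add: u' f_def)
    have "\<bar>int z - int x'\<bar> \<le> int t"
      using u z unfolding u' z(1) G_def by (subst (asm) gball_grid) auto
    then show "u \<in> C" if "r (pair_ident i j u) < r (pair_ident i j v)"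
      using pair_closed[OF ij z(2,3) u_in] that by (simp add: u' z(1) C_def)
    fix w assume w: "w \<in> gball G v t"
    show "(f u, f w) \<in> edges (grid a b) \<longleftrightarrow> (u, w) \<in> edges G"
      using g sub subsetD[OF verts u] subsetD[OF verts w] by (intro tr(2)[of t t]) auto
  qed
  then show ?thesis by (simp add: f_def pair_color_def)
qed

section \<open>Strips of tiles and their total height differences\<close>

text \<open>The row from the center of the first tile to that of the last consists of
  \<open>k\<close> groups of \<open>w\<close> steps, each a copy of a pair. If \<open>fwd\<close>
  fails, \<open>h\<close> mirrors the strip, whose last column is \<open>k * w + 4 * t\<close>; this
  exchanges the two end centers and reverses every step, whence the sign.\<close>

lemma strip_row_sum:
  fixes fwd :: bool and k Y :: nat and xs :: "nat list"
  defines "w \<equiv> 4 * t + 1"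
  defines "h \<equiv> \<lambda>x. if fwd then x else k * w + 4 * t - x"
  assumes run: "is_run A n t r (grid a b) ident S"
    and col: "proper_coloring 3 (grid a b) (\<lambda>v. fst (S v))"
    and xs: "length xs = Suc k" "set xs \<subseteq> I"
    and size: "Suc k * w \<le> a" "Y + 2 * t < b"
    and ident: "\<And>x y. x < Suc k * w \<Longrightarrow> y < 2 * t + 1 \<Longrightarrow>
       ident (h x, Y + y) = e (xs ! (x div w)) (x mod w) y"
  shows "(\<Sum>x<k * w. color_step (fst (S (2 * t + x, Y + t))) (fst (S (2 * t + x + 1, Y + t)))) =
    (if fwd then 1 else -1) * (\<Sum>s<k. pair_sum (xs ! s) (xs ! Suc s))"
proof -
  define c where "c x = fst (S (x, Y + t))" for x
  have pair: "c (h (2 * t + (s * w + x))) = pair_color (xs ! s) (xs ! Suc s) (2 * t + x)"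
    if s: "s < k" and x: "x \<le> w" for s x
  proof -
    have "Suc s * w \<le> k * w" using s by (intro mult_le_mono1) simp
    then have sk: "s * w + w \<le> k * w" by simp
    define X where "X = (if fwd then s * w else k * w + 4 * t - s * w)"
    define g where "g x = h (s * w + x)" for x
    have "fst (S (g (2 * t + x), Y + t)) = pair_color (xs ! s) (xs ! Suc s) (2 * t + x)"
    proof (rule pair_color_transfer[OF run, where X = X])
      show "xs ! s \<in> I" "xs ! Suc s \<in> I" using xs s by (auto simp: subset_iff)
      show "g = (\<lambda>x. X + x) \<or> g = (\<lambda>x. X - x) \<and> 8 * t + 1 \<le> X"
        using sk by (auto simp: g_def h_def X_def fun_eq_iff w_def)
      show "t \<le> 2 * t + x" "2 * t + x \<le> 7 * t + 1" using x by (auto simp: w_def)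
      fix z y :: nat assume z: "z < 8 * t + 2" and y: "y < 2 * t + 1"
      have zk: "s * w + z < Suc k * w" using z sk by (simp add: w_def)
      then have "g z < a" using size by (auto simp: g_def h_def w_def)
      moreover have "Y + y < b" using size y by simp
      moreover have "ident (g z, Y + y) = pair_ident (xs ! s) (xs ! Suc s) (z, y)"
      proof (cases "z < w")
        case True
        then have "(s * w + z) div w = s" "(s * w + z) mod w = z" by auto
        then show ?thesis
          using ident[OF zk y] True by (simp add: g_def pair_ident_def w_def)
      next
        case False
        define z' where "z' = z - w"
        have z': "s * w + z = Suc s * w + z'" "z' < w" using False z by (auto simp: z'_def w_def)
        have "(Suc s * w + z') div w = Suc s" "(Suc s * w + z') mod w = z'"
          using z'(2) by (simp_all only: div_mult_self3 mod_mult_self3 div_less mod_less)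
        then have "(s * w + z) div w = Suc s" "(s * w + z) mod w = z - w"
          unfolding z'(1) by (simp_all only: z'_def)
        then show ?thesis
          using ident[OF zk y] False by (simp add: g_def pair_ident_def w_def)
      qed
      ultimately show "g z < a \<and> Y + y < b \<and>
          ident (g z, Y + y) = pair_ident (xs ! s) (xs ! Suc s) (z, y)" by blast
    qed
    then show ?thesis by (simp add: c_def g_def algebra_simps)
  qed
  define F where "F x = color_step (c (h (2 * t + x))) (c (h (2 * t + x + 1)))" for x
  have "(\<Sum>x<k * w. F x) = (\<Sum>s<k. sum F {s * w..<s * w + w})"
    by (rule sum.nat_group[symmetric])
  also have "\<dots> = (\<Sum>s<k. pair_sum (xs ! s) (xs ! Suc s))"
  proof (intro sum.cong refl)
    fix s assume "s \<in> {..<k}"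
    then have s: "s < k" by simp
    have "sum F {s * w..<s * w + w} = (\<Sum>x<w. F (s * w + x))"
      using sum.shift_bounds_nat_ivl[of F 0 "s * w" w]
      by (simp add: add.commute atLeast0LessThan)
    also have "\<dots> = pair_sum (xs ! s) (xs ! Suc s)"
      unfolding pair_sum_def w_def[symmetric]
    proof (intro sum.cong refl)
      fix x assume "x \<in> {..<w}"
      then show "F (s * w + x) = color_step (pair_color (xs ! s) (xs ! Suc s) (2 * t + x))
          (pair_color (xs ! s) (xs ! Suc s) (2 * t + x + 1))"
        using pair[OF s, of x] pair[OF s, of "Suc x"] by (simp add: F_def)
    qed
    finally show "sum F {s * w..<s * w + w} = pair_sum (xs ! s) (xs ! Suc s)" .
  qed
  finally have F: "(\<Sum>x<k * w. F x) = (\<Sum>s<k. pair_sum (xs ! s) (xs ! Suc s))" .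
  define E where "E x = color_step (c (2 * t + x)) (c (2 * t + x + 1))" for x
  have "(\<Sum>x<k * w. E x) = (if fwd then 1 else -1) * (\<Sum>x<k * w. F x)"
  proof (cases fwd)
    case True
    then show ?thesis by (simp add: E_def F_def h_def)
  next
    case False
    \<comment> \<open>After reversing the summation, step \<open>k * w - Suc x\<close> of
      \<open>E\<close> and step \<open>x\<close> of \<open>F\<close> join the same two nodes in
      opposite directions.\<close>
    have "(\<Sum>x<k * w. E x) = (\<Sum>x<k * w. E (k * w - Suc x))"
      by (rule sum.nat_diff_reindex[symmetric])
    also have "\<dots> = (\<Sum>x<k * w. - F x)"
    proof (intro sum.cong refl)
      fix x assume "x \<in> {..<k * w}"
      then have x: "x < k * w" by simp
      define z where "z = 2 * t + (k * w - Suc x)"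
      have z: "h (2 * t + x) = z + 1" "h (2 * t + x + 1) = z" "z + 1 < a"
        using x False size by (auto simp: z_def h_def w_def)
      have "color_step (c z) (c (z + 1)) = - color_step (c (z + 1)) (c z)"
        unfolding c_def
      proof (rule color_step_swap)
        have "((z + 1, Y + t), (z, Y + t)) \<in> edges (grid a b)"
          using z(3) size by (simp add: edges_grid)
        then show "fst (S (z + 1, Y + t)) \<noteq> fst (S (z, Y + t))"
          using col unfolding proper_coloring_def by blast
      qed (use col z(3) size in \<open>auto simp: proper_coloring_def verts_grid\<close>)
      then show "E (k * w - Suc x) = - F x"
        using z by (simp add: E_def F_def z_def)
    qed
    finally show ?thesis using False by (simp add: sum_negf)
  qed
  then show ?thesis using F by (simp add: E_def c_def)
qed

text \<open>As no \<open>pair_sum\<close> vanishes, a pair failing \<open>L\<close> has sum at most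
  \<open>-1\<close>. Both outcomes of \<open>monochromatic_chain\<close> thus give \<open>k\<close>
  summands of one sign, which \<open>fwd\<close> records.\<close>

lemma oriented_chain:
  assumes "finite J" "J \<subseteq> I" "k * k < card J"
  obtains xs fwd where "length xs = Suc k" "distinct xs" "set xs \<subseteq> J"
    and "int k \<le> (if fwd then 1 else -1) * (\<Sum>s<k. pair_sum (xs ! s) (xs ! Suc s))"
proof -
  define L where "L i j \<longleftrightarrow> pair_sum i j > 0" for i j
  obtain xs fwd where xs: "length xs = Suc k" "set xs \<subseteq> J" "sorted_wrt (<) xs"
    and L: "successively (\<lambda>i j. L i j = fwd) xs"
  proof -
    have "(\<lambda>i j. L i j = True) = L" "(\<lambda>i j. L i j = False) = (\<lambda>i j. \<not> L i j)"
      by simp_all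
    then show thesis
      using monochromatic_chain[OF assms(1,3), of L] that[of _ True] that[of _ False] by metis
  qed
  have "1 \<le> (if fwd then 1 else -1) * pair_sum (xs ! s) (xs ! Suc s)" if "s < k" for s
  proof -
    have "L (xs ! s) (xs ! Suc s) = fwd"
      using L xs(1) that by (auto simp: successively_conv_nth)
    then show ?thesis
      using pair_sum_nonzero[of "xs ! s" "xs ! Suc s"] by (auto simp: L_def)
  qed
  then have "(\<Sum>s<k. 1) \<le> (\<Sum>s<k. (if fwd then 1 else -1) * pair_sum (xs ! s) (xs ! Suc s))"
    by (intro sum_mono) auto
  then show ?thesis
    using xs by (intro that[of xs fwd]) (auto simp: sum_distrib_left strict_sorted_iff)
qed

end

section \<open>Choice of the grid and the contradiction\<close>

text \<open>With \<open>n = m * m\<close>, the asymptotic bound becomes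
  \<open>t ^ 10 \<le> m * m\<close>, that is \<open>s ^ 5 \<le> m ^ 2\<close> for
  \<open>s = t ^ 2\<close>, so \<open>m\<close> outgrows every multiple of \<open>s\<close>.\<close>

lemma side_length_exists:
  assumes "(\<lambda>n. real (T n)) \<in> o(\<lambda>n. real n powr (1 / 10))"
  obtains m :: nat where "12 * (T (m * m) + 1)^2 \<le> m"
proof -
  have "eventually (\<lambda>n. norm (real (T n)) \<le> 1 * norm (real n powr (1 / 10))) sequentially"
    using assms by (rule landau_o.smallD) simp
  then obtain n0 where n0: "\<And>n. n \<ge> n0 \<Longrightarrow> real (T n) \<le> real n powr (1 / 10)"
    by (auto simp: eventually_sequentially)
  \<comment> \<open>\<open>n0\<close> makes the asymptotic bound valid at \<open>m * m\<close>;
    \<open>1000\<close> covers \<open>48 * s\<close> for \<open>s \<le> 14\<close> and the constant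
    \<open>12\<close> for \<open>t = 0\<close>.\<close>
  define m where "m = n0 + 1000"
  define t where "t = T (m * m)"
  define s where "s = t\<^sup>2"
  have "n0 \<le> m * m" by (simp add: m_def algebra_simps)
  then have "real t ^ 10 \<le> (real (m * m) powr (1 / 10)) ^ 10"
    unfolding t_def by (intro power_mono n0) simp_all
  also have "\<dots> = real (m * m)"
    by (simp add: m_def powr_power)
  finally have "real (t ^ 10) \<le> real (m * m)" by simp
  then have "t ^ 10 \<le> m * m" by (simp only: of_nat_le_iff)
  then have s5: "s ^ 5 \<le> m\<^sup>2" by (simp add: s_def power2_eq_square[of m] flip: power_mult)
  have "48 * s \<le> m"
  proof (cases "s \<le> 14")
    case True
    then show ?thesis by (simp add: m_def)
  next
    case False
    then have "14 ^ 3 \<le> s ^ 3" by (intro power_mono) simp_all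
    then have "48\<^sup>2 * s\<^sup>2 \<le> s ^ 3 * s\<^sup>2" by (intro mult_le_mono1) simp
    then have "(48 * s)\<^sup>2 \<le> m\<^sup>2"
      using s5 by (simp add: power_mult_distrib flip: power_add)
    then show ?thesis by (rule power2_le_imp_le) simp
  qed
  moreover have "12 * (t + 1)\<^sup>2 \<le> max 12 (48 * s)"
  proof (cases "t = 0")
    case False
    then have "(t + 1)\<^sup>2 \<le> (2 * t)\<^sup>2" by (intro power_mono) simp_all
    then show ?thesis by (simp add: s_def power_mult_distrib)
  qed simp
  ultimately have "12 * (t + 1)\<^sup>2 \<le> m" by (simp add: m_def)
  then show ?thesis using that by (simp add: t_def)
qed

lemma slocal_three_coloring_contradiction:
  fixes A :: "('m, nat) slocal_alg" and T N :: "nat \<Rightarrow> nat" and m :: nat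
  assumes ids: "m * m \<le> N (m * m)"
    and large: "12 * (T (m * m) + 1)^2 \<le> m"
    and solves: "slocal_solves A T N grids (proper_coloring 3)"
  shows False
proof -
  define n where "n = m * m"
  define t where "t = T n"
  define w where "w = 4 * t + 1"
  define h where "h = 2 * t + 1"
  \<comment> \<open>The middle rows of two stacked strips are \<open>h\<close> apart, so their sums
    differ by at most \<open>2 * h = 4 * t + 2\<close>, whereas totals of opposite sign and size at
    least \<open>k\<close> differ by at least \<open>2 * k = 4 * t + 4\<close>.\<close>
  define k where "k = 2 * t + 2"
  define K where "K = k * k + 1"
  have m: "12 * (t + 1)\<^sup>2 \<le> m" using large by (simp add: t_def n_def)
  have u: "t + 1 \<le> (t + 1)\<^sup>2" by (simp add: power2_eq_square)
  have "Suc k * w \<le> (3 * (t + 1)) * (4 * (t + 1))"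
    unfolding k_def w_def by (intro mult_le_mono) simp_all
  also have "\<dots> = 12 * (t + 1)\<^sup>2" by (simp add: power2_eq_square algebra_simps)
  finally have width: "Suc k * w \<le> m" using m by simp
  have height: "2 * h \<le> m" using m u by (simp add: h_def)
  \<comment> \<open>All \<open>2 * K\<close> candidate tiles receive distinct identifiers in
    advance, because the chains are chosen only after identifiers and ranks are fixed. Hence the
    candidates must fit into \<open>n\<close> although only \<open>2 * (k + 1)\<close> tiles are
    placed.\<close>
  have "2 * K * (w * h) \<le> (2 * (5 * (t + 1)\<^sup>2)) * ((4 * (t + 1)) * (2 * (t + 1)))"
    using u unfolding K_def k_def w_def h_def
    by (intro mult_le_mono) (simp_all add: power2_eq_square algebra_simps)
  also have "\<dots> \<le> (12 * (t + 1)\<^sup>2) * (12 * (t + 1)\<^sup>2)"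
    by (simp add: power2_eq_square algebra_simps)
  also have "\<dots> \<le> n" unfolding n_def using m by (intro mult_le_mono)
  finally have area: "2 * K * (w * h) \<le> n" .

  define D where "D = {..<2 * K} \<times> {..<w} \<times> {..<h}"
  have "card D \<le> card {1..n}" using area by (simp add: D_def)
  then obtain e0 where e0: "inj_on e0 D" "e0 ` D \<subseteq> {1..n}"
    using inj_on_iff_card_le[of D "{1..n}"] by (auto simp: D_def)
  define e where "e i x y = e0 (i, x, y)" for i x y
  have e_inj: "i = i' \<and> x = x' \<and> y = y'"
    if "e i x y = e i' x' y'" "i < 2 * K" "x < w" "y < h" "i' < 2 * K" "x' < w" "y' < h"
    for i i' x x' y y'
    using inj_onD[OF e0(1), of "(i, x, y)" "(i', x', y')"] that by (simp add: e_def D_def)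
  have e_range: "e i x y \<in> {1..n}" if "i < 2 * K" "x < w" "y < h" for i x y
    unfolding e_def using that by (intro subsetD[OF e0(2)] imageI) (simp add: D_def)

  define Block where "Block = {e i x t | i x. i < 2 * K \<and> t \<le> x \<and> x \<le> 3 * t}"
  define Row where "Row = {e i x t | i x. i < 2 * K \<and> x < w}"
  define phase :: "nat \<Rightarrow> nat" where
    "phase a = (if a \<in> Block then 0 else if a \<in> Row then 1 else 2)" for a
  \<comment> \<open>Lexicographic order by phase and identifier: \<open>n + 1\<close> exceeds every
    identifier.\<close>
  define r where "r a = phase a * (n + 1) + a" for a
  have phase_mono: "phase a \<le> phase b" if "r a < r b" "b \<in> {1..n}" for a b
  proof (rule ccontr)
    assume "\<not> phase a \<le> phase b"
    then have "Suc (phase b) * (n + 1) \<le> phase a * (n + 1)" by (intro mult_le_mono1) simp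
    then show False using that by (simp add: r_def)
  qed
  have r_inj: "inj_on r {1..n}"
  proof (rule inj_onI)
    fix a b assume ab: "a \<in> {1..n}" "b \<in> {1..n}" "r a = r b"
    have "r c mod (n + 1) = c" if "c \<in> {1..n}" for c
      using that unfolding r_def by (simp only: mod_mult_self3) simp
    then show "a = b" using ab by metis
  qed
  have t_less: "t < h" by (simp add: h_def)
  have "tiling t r e {..<2 * K}"
  proof
    fix i j x y x'
    assume ij: "i \<in> {..<2 * K}" "j \<in> {..<2 * K}" and x: "x < 4 * t + 1" and y: "y < 2 * t + 1"
    show "y = t" if x': "x' < 4 * t + 1" and less: "r (e i x y) < r (e j x' t)"
    proof -
      have "e j x' t \<in> Row" using ij x' by (auto simp: Row_def w_def)
      then have "phase (e i x y) \<le> 1"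
        using phase_mono[OF less] e_range[of j x' t] ij x' t_less
        by (simp add: phase_def w_def split: if_splits)
      then have "e i x y \<in> Block \<union> Row" by (auto simp: phase_def split: if_splits)
      then obtain i' z where "e i x y = e i' z t" "i' < 2 * K" "z < w"
        by (auto simp: Block_def Row_def w_def)
      then show ?thesis using e_inj[of i x y i' z t] ij x y t_less by (simp add: w_def h_def)
    qed
    show "t \<le> x \<and> x \<le> 3 * t" if x': "t \<le> x'" "x' \<le> 3 * t" and less: "r (e i x y) < r (e j x' t)"
    proof -
      have "e j x' t \<in> Block" using ij x' by (auto simp: Block_def)
      then have "phase (e i x y) = 0"
        using phase_mono[OF less] e_range[of j x' t] ij x' t_less
        by (simp add: phase_def w_def split: if_splits)
      then have "e i x y \<in> Block" by (auto simp: phase_def split: if_splits)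
      then obtain i' z where "e i x y = e i' z t" "i' < 2 * K" "t \<le> z" "z \<le> 3 * t"
        by (auto simp: Block_def)
      then show ?thesis using e_inj[of i x y i' z t] ij x y t_less by (simp add: w_def h_def)
    qed
  qed
  then interpret tiling A n t r e "{..<2 * K}" .

  \<comment> \<open>The two index sets are disjoint, so the two strips share no identifier.\<close>
  obtain xs0 fwd0 where 0: "length xs0 = Suc k" "distinct xs0" "set xs0 \<subseteq> {..<K}"
    "int k \<le> (if fwd0 then 1 else -1) * (\<Sum>s<k. pair_sum (xs0 ! s) (xs0 ! Suc s))"
    by (rule oriented_chain[of "{..<K}" k]) (auto simp: K_def)
  obtain xs1 bwd1 where 1: "length xs1 = Suc k" "distinct xs1" "set xs1 \<subseteq> {K..<2 * K}"
    "int k \<le> (if bwd1 then 1 else -1) * (\<Sum>s<k. pair_sum (xs1 ! s) (xs1 ! Suc s))"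
    by (rule oriented_chain[of "{K..<2 * K}" k]) (auto simp: K_def)
  define tile where "tile z = (if z = 0 then xs0 else xs1)" for z :: nat
  \<comment> \<open>Strip 0 is oriented so that its total is at least \<open>k\<close>, strip 1 the
    opposite way, so that its total is at most \<open>-k\<close>.\<close>
  define fwd where "fwd z = (if z = 0 then fwd0 else \<not> bwd1)" for z :: nat
  define flip where "flip z x = (if fwd z then x else k * w + 4 * t - x)" for z x
  define Z where "Z = {..<Suc k * w} \<times> {..<2 * h}"
  define ident0 where "ident0 = (\<lambda>(x, y).
      e (tile (y div h) ! (flip (y div h) x div w)) (flip (y div h) x mod w) (y mod h))"
  have flip_less: "flip z x < Suc k * w" if "x < Suc k * w" for z x
    using that by (auto simp: flip_def w_def)
  have flip_flip: "flip z (flip z x) = x" if "x < Suc k * w" for z x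
    using that by (auto simp: flip_def w_def)
  have pos: "0 < w" "0 < h" by (simp_all add: w_def h_def)
  have div_less': "x div w < Suc k" if "x < Suc k * w" for x
    using that by (simp add: less_mult_imp_div_less)
  have tile_less: "tile z ! s < 2 * K" "tile z ! s < K \<longleftrightarrow> z = 0" if "s < Suc k" for z s
    using 0(1) 1(1) that subsetD[OF 0(3) nth_mem, of s] subsetD[OF 1(3) nth_mem, of s]
    by (auto simp: tile_def)
  have inj0: "inj_on ident0 Z"
  proof (rule inj_onI)
    fix p q assume p: "p \<in> Z" and q: "q \<in> Z" and eq: "ident0 p = ident0 q"
    obtain x y x' y' where pq: "p = (x, y)" "q = (x', y')" by fastforce
    define z z' where "z = y div h" and "z' = y' div h"
    have x: "x < Suc k * w" "x' < Suc k * w" and y: "y < 2 * h" "y' < 2 * h"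
      using p q by (auto simp: pq Z_def)
    have s: "flip z x div w < Suc k" "flip z' x' div w < Suc k"
      using x by (intro div_less' flip_less; simp)+
    have "tile z ! (flip z x div w) = tile z' ! (flip z' x' div w) \<and>
        flip z x mod w = flip z' x' mod w \<and> y mod h = y' mod h"
      using eq tile_less(1) s pos
      by (intro e_inj) (auto simp: ident0_def pq z_def z'_def)
    then have E: "tile z ! (flip z x div w) = tile z' ! (flip z' x' div w)"
      "flip z x mod w = flip z' x' mod w" "y mod h = y' mod h" by blast+
    have "z < 2" "z' < 2" using y by (simp_all add: z_def z'_def less_mult_imp_div_less)
    \<comment> \<open>Tile indices below \<open>K\<close> occur in strip 0 only, so equal tiles lie
      in the same strip; distinctness of its chain then fixes the position.\<close>
    moreover have "z = 0 \<longleftrightarrow> z' = 0" using tile_less(2)[OF s(1)] tile_less(2)[OF s(2)] E(1) by metis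
    ultimately have z: "z = z'" by linarith
    then have "y = y'"
      using E(3) div_mult_mod_eq[of y h] div_mult_mod_eq[of y' h] unfolding z_def z'_def by metis
    moreover have "flip z x div w = flip z x' div w"
      using E(1) s 0(1,2) 1(1,2) by (auto simp: z tile_def nth_eq_iff_index_eq split: if_splits)
    then have "flip z x = flip z x'"
      using E(2) z div_mult_mod_eq[of "flip z x" w] div_mult_mod_eq[of "flip z x'" w] by metis
    then have "x = x'" using flip_flip x by metis
    ultimately show "p = q" by (simp add: pq)
  qed
  have range0: "ident0 ` Z \<subseteq> {1..n}"
  proof clarify
    fix x y assume "(x, y) \<in> Z"
    then have "flip (y div h) x div w < Suc k" by (intro div_less' flip_less) (simp add: Z_def)
    then show "ident0 (x, y) \<in> {1..n}"
      unfolding ident0_def prod.case using tile_less(1) pos by (intro e_range) auto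
  qed
  have sub0: "Z \<subseteq> verts (grid m m)" using width height by (auto simp: Z_def verts_grid)
  have fin: "finite (verts (grid m m))" by (simp add: verts_grid)
  have card: "card (verts (grid m m)) = n" by (simp add: verts_grid n_def)
  then have card_le: "card (verts (grid m m)) \<le> card {1..n}" by simp
  obtain ident where ident: "inj_on ident (verts (grid m m))"
    "ident ` verts (grid m m) \<subseteq> {1..n}" "\<forall>v\<in>Z. ident v = ident0 v"
    by (rule inj_on_extend[OF fin finite_atLeastAtMost card_le sub0 inj0 range0])

  have "m \<ge> 1" using height pos by linarith
  then have in_grids: "grid m m \<in> grids" unfolding grids_def by blast
  have ident_N: "ident ` verts (grid m m) \<subseteq> {1..N n}" using ident(2) ids by (force simp: n_def)
  have r_inj': "inj_on r (ident ` verts (grid m m))" using r_inj ident(2) by (rule inj_on_subset)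
  obtain S where run: "is_run A n t r (grid m m) ident S"
    and col: "proper_coloring 3 (grid m m) (\<lambda>v. fst (S v))"
    by (rule run_of_solves[OF solves in_grids fin ident(1) _ r_inj',
          unfolded card, OF ident_N, folded t_def])

  define row where "row y = (\<Sum>x<k * w.
      color_step (fst (S (2 * t + x, y))) (fst (S (2 * t + x + 1, y))))" for y
  have row: "row (z * h + t) =
      (if fwd z then 1 else -1) * (\<Sum>s<k. pair_sum (tile z ! s) (tile z ! Suc s))"
    if z: "z < 2" for z
    unfolding row_def w_def
  proof (rule strip_row_sum[OF run col])
    show "length (tile z) = Suc k" "set (tile z) \<subseteq> {..<2 * K}"
      using 0(1,3) 1(1,3) by (auto simp: tile_def)
    show "Suc k * (4 * t + 1) \<le> m" using width by (simp only: w_def)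
    have "Suc z * h \<le> 2 * h" using z by (intro mult_le_mono1) simp
    then have zh: "z * h + h \<le> 2 * h" by (simp only: mult_Suc add.commute)
    then show "z * h + 2 * t < m" using height by (simp add: h_def)
    fix x y assume "x < Suc k * (4 * t + 1)" and y: "y < 2 * t + 1"
    then have x: "x < Suc k * w" by (simp only: w_def)
    have "y < h" using y by (simp add: h_def)
    then have dm: "(z * h + y) div h = z" "(z * h + y) mod h = y" by auto
    have "z * h + y < 2 * h" using zh \<open>y < h\<close> by linarith
    then have "(flip z x, z * h + y) \<in> Z" using flip_less[OF x] by (simp add: Z_def)
    then have "ident (flip z x, z * h + y) = e (tile z ! (x div w)) (x mod w) y"
      using ident(3) \<open>y < h\<close> by (simp add: ident0_def dm flip_flip[OF x])
    then show "ident (if fwd z then x else k * (4 * t + 1) + 4 * t - x, z * h + y) =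
        e (tile z ! (x div (4 * t + 1))) (x mod (4 * t + 1)) y"
      unfolding flip_def w_def .
  qed
  have "2 * t + k * w < m" "t + h < m" using width height by (auto simp: w_def h_def)
  from row_sums_close[OF col this] have "\<bar>row t - row (t + h)\<bar> \<le> 2 * int h"
    unfolding row_def .
  moreover have "int k \<le> row t"
    using 0(4) row[of 0] by (simp add: fwd_def tile_def)
  moreover have "row (t + h) \<le> - int k"
    using 1(4) row[of 1] by (auto simp: fwd_def tile_def add.commute split: if_splits)
  ultimately show False by (simp add: h_def k_def)
qed

theorem theorem4p1:
  fixes N :: "nat \<Rightarrow> nat"
  assumes enough_ids: "\<And>n. n \<le> N n"
    and poly_ids: "\<exists>c::nat. (\<lambda>n. real (N n)) \<in> O(\<lambda>n. real n ^ c)"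
  shows "\<not> (\<exists>(A :: ('m, nat) slocal_alg) (T :: nat \<Rightarrow> nat).
              (\<lambda>n. real (T n)) \<in> o(\<lambda>n. real n powr (1 / 10)) \<and>
              slocal_solves A T N grids (proper_coloring 3))"
proof clarify
  fix A :: "('m, nat) slocal_alg" and T :: "nat \<Rightarrow> nat"
  assume T: "(\<lambda>n. real (T n)) \<in> o(\<lambda>n. real n powr (1 / 10))"
    and solves: "slocal_solves A T N grids (proper_coloring 3)"
  from T obtain m where "12 * (T (m * m) + 1)^2 \<le> m" by (rule side_length_exists)
  then show False using slocal_three_coloring_contradiction enough_ids solves by blast
qed

end
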